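(* Let $n,m\ge1$, data $(\boldsymbol h_i,y_i)_{i\in[n]}$, $\boldsymbol K,\boldsymbol H,\boldsymbol y,C$, the gradient flow $\boldsymbol a(t),\boldsymbol v(t)$, the function $L_{\mathcal D}^*(t)$, its derivative $dL_{\mathcal D}^*/dt$, the eigenvalues $\lambda_1\ge\dots\ge\lambda_n\ge0$ of $\boldsymbol H$, the index $\alpha\in[n]$, the functions $\Gamma_i,\Gamma,\Omega,\Phi$, the sign-invariant interval $\mathcal T_1=[0,\tau_1)$, the set $I_-(\mathcal T_1)$ and the times $t^*$, $t^+$ be as defined in the context, and suppose $\Phi(0)>0$. Then for all $t\ge 0$ $$\frac{dL_{\mathcal D}^*(t)}{dt}<0\quad\text{if and only if}\quad\Phi(t)>0,$$ and $$t^+=\sup_{s\in\mathcal T_1}\Big\{s:\ \frac{dL_{\mathcal D}^*(t)}{dt}<0\ \ \forall t\in[0,s)\Big\},\qquad t^+\le t^*.$$ There are two cases: (1) if $t^*\in\mathcal T_1$, then $t^+=t^*<\tau_1$; (2) if $t^*\notin\mathcal T_1$, then $t^+=\tau_1\le t^*$. Suppose furthermore that $I_-(\mathcal T_1)=\emptyset$ and $\Gamma(0)>\Omega(0)>0$. Then $$t_1^+\le t^+\le t_\alpha^+,$$ where, for $i\in\{1,\alpha\}$, $$t_i^+=\sup_{s\in\mathcal T_1}\Big\{s:\ t<\frac1{\lambda_i}\ln\frac{\Gamma(t)}{\Omega(t)}\ \ \forall t\in[0,s)\Big\}.$$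
   Context: Notation: $[n]=\{1,\dots,n\}$; $\mathrm{sgn}(v)=1$ if $v\ge0$ and $-1$ if $v<0$, applied componentwise to vectors; $\boldsymbol K^\dagger$ is the Moore–Penrose pseudoinverse; $\sup_{s\in A}\{s:P(s)\}$ means $\sup\{s\in A: P(s)\}$. Setting. $(\boldsymbol h_1,y_1),\dots,(\boldsymbol h_n,y_n)\in\mathbb R^m\times\mathbb R$; $\boldsymbol y=(y_1,\dots,y_n)^\top$; $\boldsymbol K\in\mathbb R^{n\times m}$ has $i$-th row $\boldsymbol h_i^\top$; $\boldsymbol H=\boldsymbol K\boldsymbol K^\top$; $C>0$ is a constant (in the paper, one with $\mathbb E_{\boldsymbol h\sim\mathcal D}\|\boldsymbol h\|_2^2\le C^2$ for the data distribution $\mathcal D$). The gradient flow $\boldsymbol a:[0,\infty)\to\mathbb R^m$ solves $\frac{d\boldsymbol a}{dt}=-\boldsymbol K^\top\boldsymbol v$, $\boldsymbol a(0)=0$, with $\boldsymbol v(t)=\boldsymbol K\boldsymbol a(t)-\boldsymbol y$; hence $\frac{d\boldsymbol v}{dt}=-\boldsymbol H\boldsymbol v$. Put $$L_{\mathcal D}^*(t)=\frac1n\|\boldsymbol v(t)\|_1+\frac{2C\|\boldsymbol a(t)\|_2}{\sqrt n},\qquad \Psi(t)=-\frac{2C}{\sqrt n}\frac{(\boldsymbol K^\dagger(\boldsymbol v(t)+\boldsymbol y))^\top}{\|\boldsymbol K^\dagger(\boldsymbol v(t)+\boldsymbol y)\|_2}\boldsymbol K^\top\boldsymbol v(t),$$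 where $\boldsymbol K^\dagger(\boldsymbol v(t)+\boldsymbol y)=\boldsymbol a(t)$. At $t=0$, where the quotient is $0/0$, $\Psi(0)$ is the limit $\lim_{t\to0^+}\Psi(t)=\frac{2C}{\sqrt n}\|\boldsymbol K^\top\boldsymbol y\|_2$; if $\boldsymbol K^\top\boldsymbol y=0$ (so $\boldsymbol a\equiv0$), $\Psi\equiv0$. Derivative convention. $dL_{\mathcal D}^*/dt$ is the derivative of $L_{\mathcal D}^*$; at $t=0$ and at times where $L_{\mathcal D}^*$ is not differentiable because a component of $\boldsymbol v$ vanishes, it is understood with the convention $\frac{d|x|}{dx}=\mathrm{sgn}(x)$, i.e. as the value of $-\frac1n(\mathrm{sgn}(\boldsymbol v(t)))^\top\boldsymbol H\boldsymbol v(t)+\Psi(t)$, an expression which equals the derivative at all $t>0$ where the latter exists. Spectral data. $\lambda_1\ge\dots\ge\lambda_n\ge0$ are the eigenvalues of $\boldsymbol H$; $\boldsymbol P\in\mathbb R^{n\times n}$ is an orthogonal matrix with $\boldsymbol H=\boldsymbol P\,\mathrm{diag}(\lambda_1,\dots,\lambda_n)\boldsymbol P^\top$ and columns $\boldsymbol P_i$; $U_i$ is the $i$-th component of $\boldsymbol P^\top\boldsymbol v(0)$ and $\boldsymbol w_i=U_i\boldsymbol P_i$, so that $\boldsymbol v(t)=\sum_{i=1}^n\boldsymbol w_ie^{-\lambda_it}$. The index $\alpha\in[n]$ separates the eigenvalues into the large ones $\lambda_1,\dots,\lambda_\alpha$ and the remaining ones $\lambda_{\alpha+1},\dots,\lambda_n$.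 Define $$\Gamma_i(t)=(\mathrm{sgn}(\boldsymbol v(t)))^\top\boldsymbol H\boldsymbol w_i\ (i\in[\alpha]),\quad \Gamma(t)=\sum_{i\in[\alpha]}\Gamma_i(t),\quad \Delta(t)=(\mathrm{sgn}(\boldsymbol v(t)))^\top\boldsymbol H\sum_{j=\alpha+1}^n\boldsymbol w_je^{-\lambda_jt},$$ $$\Omega(t)=n\Psi(t)-\Delta(t),\qquad \Phi(t)=\sum_{i\in[\alpha]}\Gamma_i(t)e^{-\lambda_it}-\Omega(t).$$ Sign-invariant interval. Time is decomposed into contiguous intervals $\mathcal T_1,\mathcal T_2,\dots$ on each of which the signs of all $\Gamma_i$ ($i\in[\alpha]$) and of $\Omega$ are invariant: on each such interval $\mathcal T$, for each $i\in[\alpha]$, either $\Gamma_i(t)>0$ for all $t\in\mathcal T$ or $\Gamma_i(t)\le0$ for all $t\in\mathcal T$, and likewise either $\Omega(t)>0$ for all $t\in\mathcal T$ or $\Omega(t)\le0$ for all $t\in\mathcal T$. The first interval is assumed to be of the form $\mathcal T_1=[0,\tau_1)$ with $\tau_1>0$. Set $I_-(\mathcal T_1)=\{i\in[\alpha]:\Gamma_i(t)\le0\ \forall t\in\mathcal T_1\}$. Times. $$t^*=\inf\Big\{t\ge0:\frac{dL_{\mathcal D}^*(t)}{dt}\ge0\Big\},\qquad t^+=\sup_{s\in\mathcal T_1}\{s:\Phi(t)>0\ \ \forall t\in[0,s)\}$$ (with $\inf\emptyset=+\infty$). *)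

theory Defs
  imports "HOL-Analysis.Analysis"
begin

text \<open>Unlike the library's \<^const>\<open>sgn\<close>, the sign at 0 is 1.\<close>
definition sgn1 :: "real \<Rightarrow> real" where
  "sgn1 x = (if x \<ge> 0 then 1 else - 1)"

definition sgn_vec :: "real^'n \<Rightarrow> real^'n" where
  "sgn_vec x = (\<chi> i. sgn1 (x $ i))"

definition is_pseudoinverse :: "real^'m^'n \<Rightarrow> real^'n^'m \<Rightarrow> bool" where
  "is_pseudoinverse A X \<longleftrightarrow>
     A ** X ** A = A \<and> X ** A ** X = X \<and>
     transpose (A ** X) = A ** X \<and> transpose (X ** A) = X ** A"

definition pseudoinverse :: "real^'m^'n \<Rightarrow> real^'n^'m" where
  "pseudoinverse A = (THE X. is_pseudoinverse A X)"

definition diag_mat :: "('n \<Rightarrow> real) \<Rightarrow> real^'n^'n" where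
  "diag_mat d = (\<chi> i j. if i = j then d i else 0)"

definition sign_invariant_on :: "(real \<Rightarrow> real) \<Rightarrow> real set \<Rightarrow> bool" where
  "sign_invariant_on f T \<longleftrightarrow> (\<forall>t\<in>T. f t > 0) \<or> (\<forall>t\<in>T. f t \<le> 0)"

text \<open>
  The finite linearly ordered index type \<^typ>\<open>'n\<close> plays the role of the set of
  the first \<^term>\<open>CARD('n)\<close> positive integers; its least element is the index 1.
  The locale has no assumptions; it only carries the parameters of the definitions:
  data \<open>h\<close>, \<open>y\<close>, the constant \<open>C\<close>, the curve \<open>a\<close> (relevant for nonnegative times),
  the eigenvalues \<open>lam\<close>, the eigenvector matrix \<open>P\<close>, the index \<open>\<alpha>\<close>, and the right end
  \<open>\<tau>\<close> of the first sign-invariant interval, which may be infinite.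
\<close>
locale flow =
  fixes h :: "'n::{finite,linorder} \<Rightarrow> real^'m"
    and y :: "real^'n::_"
    and C :: real
    and a :: "real \<Rightarrow> real^'m"
    and lam :: "'n \<Rightarrow> real"
    and P :: "real^'n::_^'n::_"
    and \<alpha> :: 'n
    and \<tau> :: ereal
begin

definition K :: "real^'m^'n::_" where
  "K = (\<chi> i. h i)"

definition H :: "real^'n::_^'n::_" where
  "H = K ** transpose K"

definition v :: "real \<Rightarrow> real^'n::_" where
  "v t = K *v a t - y"

definition is_gradient_flow :: bool where
  "is_gradient_flow \<longleftrightarrow> a 0 = 0 \<and>
     (\<forall>t\<ge>0. (a has_vector_derivative - (transpose K *v v t)) (at t within {0..}))"

definition loss :: "real \<Rightarrow> real" where
  "loss t = (1 / real CARD('n)) * (\<Sum>i\<in>UNIV. \<bar>v t $ i\<bar>)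
            + 2 * C * norm (a t) / sqrt (real CARD('n))"

definition Psi_formula :: "real \<Rightarrow> real" where
  "Psi_formula t =
     (let b = pseudoinverse K *v (v t + y)
      in - (2 * C / sqrt (real CARD('n))) * (((1 / norm b) *\<^sub>R b) \<bullet> (transpose K *v v t)))"

text \<open>At time 0 the quotient in \<open>Psi_formula\<close> is 0/0, since \<open>a 0 = 0\<close>.\<close>
definition Psi :: "real \<Rightarrow> real" where
  "Psi t = (if transpose K *v y = 0 then 0
            else if t = 0 then Lim (at_right 0) Psi_formula
            else Psi_formula t)"

text \<open>
  The derivative of \<open>loss\<close>, completed by the convention that the derivative of the absolute
  value is \<^const>\<open>sgn1\<close>, at time 0 and where \<open>loss\<close> is not differentiable.
\<close>
definition dloss :: "real \<Rightarrow> real" where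
  "dloss t = (if t > 0 \<and> loss differentiable (at t) then deriv loss t
              else - (1 / real CARD('n)) * (sgn_vec (v t) \<bullet> (H *v v t)) + Psi t)"

definition spectral_data :: bool where
  "spectral_data \<longleftrightarrow>
     (\<forall>i j. i \<le> j \<longrightarrow> lam j \<le> lam i) \<and> (\<forall>i. 0 \<le> lam i) \<and>
     orthogonal_matrix P \<and> H = P ** diag_mat lam ** transpose P"

definition w :: "'n \<Rightarrow> real^'n::_" where
  "w i = ((transpose P *v v 0) $ i) *\<^sub>R column i P"

definition Gamma_i :: "'n \<Rightarrow> real \<Rightarrow> real" where
  "Gamma_i i t = sgn_vec (v t) \<bullet> (H *v w i)"

definition Gamma :: "real \<Rightarrow> real" where
  "Gamma t = (\<Sum>i\<in>{..\<alpha>}. Gamma_i i t)"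

definition Delta :: "real \<Rightarrow> real" where
  "Delta t = sgn_vec (v t) \<bullet> (H *v (\<Sum>j\<in>{\<alpha><..}. exp (- lam j * t) *\<^sub>R w j))"

definition Omega :: "real \<Rightarrow> real" where
  "Omega t = real CARD('n) * Psi t - Delta t"

definition Phi :: "real \<Rightarrow> real" where
  "Phi t = (\<Sum>i\<in>{..\<alpha>}. Gamma_i i t * exp (- lam i * t)) - Omega t"

definition T1 :: "real set" where
  "T1 = {t. 0 \<le> t \<and> ereal t < \<tau>}"

definition T1_sign_invariant :: bool where
  "T1_sign_invariant \<longleftrightarrow>
     (\<forall>i\<in>{..\<alpha>}. sign_invariant_on (Gamma_i i) T1) \<and> sign_invariant_on Omega T1"

definition I_minus :: "'n set" where
  "I_minus = {i\<in>{..\<alpha>}. \<forall>t\<in>T1. Gamma_i i t \<le> 0}"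

definition sup_time :: "(real \<Rightarrow> bool) \<Rightarrow> ereal" where
  "sup_time Q = Sup (ereal ` {s\<in>T1. \<forall>t\<in>{0..<s}. Q t})"

definition t_star :: ereal where
  "t_star = Inf (ereal ` {t. 0 \<le> t \<and> dloss t \<ge> 0})"

definition t_plus :: ereal where
  "t_plus = sup_time (\<lambda>t. Phi t > 0)"

definition t_plus_i :: "'n \<Rightarrow> ereal" where
  "t_plus_i i = sup_time (\<lambda>t. t < 1 / lam i * ln (Gamma t / Omega t))"

end

end

theory Submission
  imports Defs
begin

text \<open>
  Everything rests on the identity \<open>dloss t = - Phi t / n\<close>. Expanding \<open>v t\<close> in the eigenvectors of
  \<open>H\<close> gives it for the expression that completes the derivative by convention. Where \<open>loss\<close> is
  differentiable, a component of \<open>v\<close> that vanishes at \<open>t\<close> has derivative 0, so the value assigned to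
  the sign at 0 does not matter; and \<open>norm (a t)\<close> is differentiable for positive \<open>t\<close>, since \<open>a\<close>
  either is constantly 0 or never returns to 0. The claims about the times are then order theory, and
  the bounds on \<open>t_plus\<close> come from replacing every exponential rate in \<open>Phi\<close> by the largest or
  smallest of the leading eigenvalues.
\<close>

text \<open>This rule turns \<open>transpose A *v x\<close> into \<open>x v* A\<close>. The
  transposed form is kept, and the rule is applied only to move a matrix across an inner
  product.\<close>

declare transpose_matrix_vector [simp del]

section \<open>Moore-Penrose pseudoinverses\<close>

text \<open>\<open>A ** X\<close> and \<open>A ** Y\<close> are both the orthogonal projection onto
  the range of \<open>A\<close>, and \<open>X ** A\<close> and \<open>Y ** A\<close> both the one
  onto its row space. Once these agree, \<open>X ** A ** X\<close> and \<open>Y ** A ** Y\<close>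
  coincide.\<close>

lemma pseudoinverse_unique:
  assumes X: "is_pseudoinverse A X" and Y: "is_pseudoinverse A Y"
  shows "X = Y"
proof -
  note x = X[unfolded is_pseudoinverse_def] and y = Y[unfolded is_pseudoinverse_def]
  have "A ** X = (A ** Y) ** (A ** X)"
    using y by (simp add: matrix_mul_assoc)
  also have "\<dots> = transpose (A ** X ** A ** Y)"
    using x y by (metis matrix_mul_assoc matrix_transpose_mul)
  also have "\<dots> = A ** Y"
    using x y by simp
  finally have AX: "A ** X = A ** Y" .
  have "X ** A = (X ** A) ** (Y ** A)"
    using y by (metis matrix_mul_assoc)
  also have "\<dots> = transpose (Y ** (A ** X ** A))"
    using x y by (metis matrix_mul_assoc matrix_transpose_mul)
  also have "\<dots> = Y ** A"
    using x y by simp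
  finally have XA: "X ** A = Y ** A" .
  have "X = X ** A ** X" using x by simp
  also have "\<dots> = Y ** A ** Y" by (metis AX XA matrix_mul_assoc)
  also have "\<dots> = Y" using y by simp
  finally show ?thesis .
qed

lemma pseudoinverse_eqI: "is_pseudoinverse A X \<Longrightarrow> pseudoinverse A = X"
  unfolding pseudoinverse_def by (blast intro: the_equality pseudoinverse_unique)

text \<open>\<open>X ** A\<close> is the orthogonal projection onto the row space of
  \<open>A\<close>, so it fixes every column of \<open>transpose A\<close>.\<close>

lemma pseudoinverse_mult_transpose:
  assumes "is_pseudoinverse A X"
  shows "X ** A ** transpose A = transpose A"
proof -
  have "X ** A ** transpose A = transpose (X ** A) ** transpose A"
    using assms by (simp add: is_pseudoinverse_def)
  also have "\<dots> = transpose (A ** (X ** A))"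
    by (simp add: matrix_transpose_mul)
  also have "\<dots> = transpose A"
    using assms by (simp add: is_pseudoinverse_def matrix_mul_assoc)
  finally show ?thesis .
qed

text \<open>The squared norm of \<open>transpose M *v x\<close> is the quadratic form of
  \<open>M ** transpose M\<close> at \<open>x\<close>.\<close>

lemma matrix_mul_transpose_eq_0:
  fixes M :: "real^'m^'n"
  assumes "M ** transpose M = 0"
  shows "M = 0"
proof -
  have "transpose M *v x = 0" for x
  proof -
    have "(transpose M *v x) \<bullet> (transpose M *v x) = (M ** transpose M *v x) \<bullet> x"
      by (simp add: transpose_matrix_vector dot_lmul_matrix inner_commute flip: matrix_vector_mul_assoc)
    also have "\<dots> = 0" by (simp add: assms)
    finally show ?thesis by simp
  qed
  then have "transpose M = 0"
    by (simp add: matrix_eq)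
  then show ?thesis
    by (simp add: transpose_def vec_eq_iff)
qed

lemma matrix_sub_rdistrib: "(A - B) ** C = A ** C - B ** (C :: real^'k^'m)"
  by (vector matrix_matrix_mult_def sum_subtractf left_diff_distrib)

text \<open>Reduces the existence of a pseudoinverse of \<open>K\<close> to that of one for
  \<open>H\<close>, which is available in diagonalised form. Symmetry of \<open>G\<close> gives the
  symmetry of \<open>transpose A ** G ** A\<close>.\<close>

lemma is_pseudoinverse_gram:
  fixes A :: "real^'m^'n"
  assumes G: "is_pseudoinverse (A ** transpose A) G" and sym: "transpose G = G"
  shows "is_pseudoinverse A (transpose A ** G)"
proof -
  define B where "B = A ** transpose A"
  have B: "B ** G ** B = B" "G ** B ** G = G" "transpose (B ** G) = B ** G"
    using G by (auto simp: is_pseudoinverse_def B_def)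
  \<comment> \<open>\<open>B ** G ** B = B\<close> only says that
    \<open>M ** transpose A = 0\<close>. As \<open>transpose M\<close> begins with the factor
    \<open>transpose A\<close>, this gives \<open>M ** transpose M = 0\<close>, hence
    \<open>M = 0\<close>.\<close>
  define M where "M = (B ** G - mat 1) ** A"
  have "M ** transpose M = (B ** G - mat 1) ** B ** transpose (B ** G - mat 1)"
    by (simp add: M_def B_def matrix_transpose_mul matrix_mul_assoc)
  moreover have "(B ** G - mat 1) ** B = 0"
    using B by (simp add: matrix_sub_rdistrib)
  ultimately have "M ** transpose M = 0"
    by (simp add: matrix_matrix_mult_def vec_eq_iff)
  then have "M = 0"
    by (rule matrix_mul_transpose_eq_0)
  then have "B ** G ** A = A"
    by (simp add: M_def matrix_sub_rdistrib)
  moreover have "transpose A ** G ** A ** (transpose A ** G) = transpose A ** (G ** B ** G)"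
    by (simp add: B_def matrix_mul_assoc)
  moreover have "A ** (transpose A ** G) = B ** G"
    by (simp add: B_def matrix_mul_assoc)
  moreover have "transpose (transpose A ** G ** A) = transpose A ** G ** A"
    using sym by (simp add: matrix_transpose_mul matrix_mul_assoc)
  ultimately show ?thesis
    unfolding is_pseudoinverse_def using B by simp
qed

lemma diag_mat_mult: "diag_mat d ** diag_mat e = diag_mat (\<lambda>i. d i * e i)"
  by (simp add: diag_mat_def matrix_matrix_mult_def vec_eq_iff if_distrib[of "\<lambda>x. x * _"]
      sum.delta cong: if_cong)

lemma transpose_diag_mat [simp]: "transpose (diag_mat d) = diag_mat d"
  by (auto simp: diag_mat_def transpose_def vec_eq_iff)

lemma diag_mat_mult_vec: "(diag_mat d *v x) $ i = d i * x $ i"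
  by (simp add: diag_mat_def matrix_vector_mult_def if_distrib[of "\<lambda>x. x * _"] cong: if_cong)

text \<open>As \<open>inverse 0 = 0\<close>, nonzero eigenvalues are replaced by their reciprocals
  and zero ones stay zero, as a pseudoinverse requires.\<close>

lemma is_pseudoinverse_spectral:
  fixes P :: "real^'n^'n"
  assumes "orthogonal_matrix P"
  shows "is_pseudoinverse (P ** diag_mat d ** transpose P)
           (P ** diag_mat (\<lambda>i. inverse (d i)) ** transpose P)"
proof -
  have mul: "(P ** X ** transpose P) ** (P ** Y ** transpose P) = P ** (X ** Y) ** transpose P" for X Y
    using assms by (metis matrix_mul_assoc matrix_mul_rid orthogonal_matrix_def)
  have tr: "transpose (P ** diag_mat e ** transpose P) = P ** diag_mat e ** transpose P" for e
    by (simp add: matrix_transpose_mul matrix_mul_assoc)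
  have "d i * inverse (d i) * d i = d i"
       "inverse (d i) * d i * inverse (d i) = inverse (d i)" for i
    by (cases "d i = 0"; simp)+
  then have inv: "(\<lambda>i. d i * inverse (d i) * d i) = d"
       "(\<lambda>i. inverse (d i) * d i * inverse (d i)) = (\<lambda>i. inverse (d i))"
    by presburger+
  show ?thesis
    unfolding is_pseudoinverse_def mul diag_mat_mult tr inv by simp
qed

text \<open>
  The summands vanishing at \<open>t\<close> have a sum with a minimum at \<open>t\<close>, so their total derivative is 0;
  as each of them is bounded by that sum, all their derivatives vanish.
\<close>
lemma sum_abs_has_derivative:
  fixes f :: "'i \<Rightarrow> real \<Rightarrow> real"
  assumes fin: "finite I"
    and f: "\<And>i. i \<in> I \<Longrightarrow> (f i has_real_derivative f' i) (at t)"
    and diff: "(\<lambda>s. \<Sum>i\<in>I. \<bar>f i s\<bar>) differentiable (at t)"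
  shows "((\<lambda>s. \<Sum>i\<in>I. \<bar>f i s\<bar>) has_real_derivative (\<Sum>i\<in>I. sgn1 (f i t) * f' i)) (at t)"
proof -
  define Z where "Z = {i\<in>I. f i t = 0}"
  define g where "g s = (\<Sum>i\<in>Z. \<bar>f i s\<bar>)" for s
  define r where "r s = (\<Sum>i\<in>I-Z. \<bar>f i s\<bar>)" for s
  have ZI: "Z \<subseteq> I" "finite Z" using fin by (auto simp: Z_def)
  have split: "(\<Sum>i\<in>I. \<bar>f i s\<bar>) = r s + g s" for s
    unfolding r_def g_def using sum.subset_diff[OF ZI(1) fin] by metis
  have r: "(r has_real_derivative (\<Sum>i\<in>I-Z. sgn1 (f i t) * f' i)) (at t)"
    unfolding r_def
  proof (rule DERIV_sum)
    fix i assume i: "i \<in> I - Z"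
    then have nz: "f i t \<noteq> 0" by (auto simp: Z_def)
    have "(abs has_real_derivative sgn1 (f i t)) (at (f i t))"
      using has_derivative_norm[OF nz] nz
      unfolding has_field_derivative_def real_norm_def [abs_def]
      by (auto elim!: has_derivative_eq_rhs simp: sgn1_def sgn_real_def)
    then show "((\<lambda>s. \<bar>f i s\<bar>) has_real_derivative sgn1 (f i t) * f' i) (at t)"
      using f i by (intro DERIV_chain2) auto
  qed
  obtain D0 where D0: "((\<lambda>s. \<Sum>i\<in>I. \<bar>f i s\<bar>) has_real_derivative D0) (at t)"
    using diff by (meson real_differentiable_def)
  \<comment> \<open>The whole sum is differentiable by assumption and the nonvanishing part by
    \<open>r\<close>, so their difference \<open>g\<close> is too.\<close>
  obtain D where D: "(g has_real_derivative D) (at t)"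
    using DERIV_diff[OF D0 r] by (auto simp: split)
  have gt: "g t = 0" by (simp add: g_def Z_def)
  have g_nonneg: "g s \<ge> 0" for s by (simp add: g_def sum_nonneg)
  have "D = 0"
    using DERIV_local_min[OF D zero_less_one] g_nonneg gt by simp
  with D gt have lim: "((\<lambda>s. g s / (s - t)) \<longlongrightarrow> 0) (at t)"
    by (simp add: has_field_derivative_iff)
  have zero: "f' i = 0" if i: "i \<in> Z" for i
  proof -
    have "((\<lambda>s. f i s / (s - t)) \<longlongrightarrow> 0) (at t)"
    proof (rule Lim_null_comparison[OF _ tendsto_rabs_zero[OF lim]])
      have "\<bar>f i s\<bar> \<le> \<bar>g s\<bar>" for s
        using member_le_sum[OF i, of "\<lambda>i. \<bar>f i s\<bar>"] ZI(2) by (simp add: g_def)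
      then show "\<forall>\<^sub>F s in at t. norm (f i s / (s - t)) \<le> \<bar>g s / (s - t)\<bar>"
        by (simp add: abs_divide divide_right_mono)
    qed
    moreover have "((\<lambda>s. f i s / (s - t)) \<longlongrightarrow> f' i) (at t)"
      using f[of i] i by (auto simp: has_field_derivative_iff Z_def)
    ultimately show ?thesis
      using LIM_unique by blast
  qed
  have "((\<lambda>s. r s + g s) has_real_derivative (\<Sum>i\<in>I-Z. sgn1 (f i t) * f' i) + 0) (at t)"
    using DERIV_add[OF r D] \<open>D = 0\<close> by simp
  moreover have "(\<Sum>i\<in>I. sgn1 (f i t) * f' i) = (\<Sum>i\<in>I-Z. sgn1 (f i t) * f' i)"
    using fin zero ZI by (intro sum.mono_neutral_right) auto
  ultimately show ?thesis
    by (simp add: split)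
qed

section \<open>Spectral solution of the gradient flow\<close>

context flow
begin

text \<open>Serves to deduce \<open>transpose K *v x = 0\<close> from
  \<open>H *v x = 0\<close>.\<close>

lemma gram_inner: "(transpose K *v x) \<bullet> (transpose K *v x) = x \<bullet> (H *v x)"
  by (simp add: H_def transpose_matrix_vector dot_lmul_matrix flip: matrix_vector_mul_assoc)

text \<open>\<open>pseudoinverse\<close> is a definite description: the diagonalisation of
  \<open>H\<close> supplies a witness, and uniqueness identifies it.\<close>

lemma is_pseudoinverse_K:
  assumes "spectral_data"
  shows "is_pseudoinverse K (pseudoinverse K)"
proof -
  let ?G = "P ** diag_mat (\<lambda>i. inverse (lam i)) ** transpose P"
  have H: "K ** transpose K = P ** diag_mat lam ** transpose P" and P: "orthogonal_matrix P"
    using assms by (auto simp: spectral_data_def H_def)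
  have "transpose ?G = ?G"
    by (simp add: matrix_transpose_mul matrix_mul_assoc)
  then have "is_pseudoinverse K (transpose K ** ?G)"
    using is_pseudoinverse_gram is_pseudoinverse_spectral[OF P, of lam] H by metis
  then show ?thesis
    using pseudoinverse_eqI by metis
qed

text \<open>Derivatives are taken within \<open>{0..}\<close> because \<open>a\<close> is
  constrained only at nonnegative times; at 0 they are one-sided.\<close>

lemma v_has_derivative:
  assumes "is_gradient_flow" "t \<ge> 0"
  shows "(v has_vector_derivative - (H *v v t)) (at t within {0..})"
proof -
  have "((\<lambda>s. K *v a s) has_vector_derivative K *v (- (transpose K *v v t))) (at t within {0..})"
    using assms unfolding is_gradient_flow_def
    by (intro bounded_linear.has_vector_derivative[OF matrix_vector_mul_bounded_linear]) auto
  then have "((\<lambda>s. K *v a s - y) has_vector_derivative K *v (- (transpose K *v v t)) - 0) (at t within {0..})"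
    by (intro has_vector_derivative_diff has_vector_derivative_const)
  moreover have "K *v (- (transpose K *v v t)) - 0 = - (H *v v t)"
    by (simp add: H_def matrix_vector_mul_assoc [symmetric] linear_neg[OF matrix_vector_mul_linear])
  ultimately show ?thesis
    by (simp add: v_def[abs_def])
qed

lemma H_diagonal:
  assumes "spectral_data"
  shows "transpose P *v (H *v x) = diag_mat lam *v (transpose P *v x)"
  using assms unfolding spectral_data_def orthogonal_matrix_def
  by (metis matrix_mul_assoc matrix_mul_lid matrix_vector_mul_assoc)

text \<open>In the eigenbasis of \<open>H\<close> the flow decouples into scalar linear equations
  with decay rates \<open>lam i\<close>.\<close>

lemma spectral_coordinate:
  assumes flow: "is_gradient_flow" and sp: "spectral_data" and t: "t \<ge> 0"
  shows "(transpose P *v v t) $ i = exp (- lam i * t) * (transpose P *v v 0) $ i"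
proof -
  define u where "u s = (transpose P *v v s) $ i" for s
  have u: "(u has_vector_derivative - lam i * u s) (at s within {0..})" if "s \<ge> 0" for s
  proof -
    have "((\<lambda>s. transpose P *v v s) has_vector_derivative transpose P *v (- (H *v v s))) (at s within {0..})"
      using v_has_derivative[OF flow that]
      by (intro bounded_linear.has_vector_derivative[OF matrix_vector_mul_bounded_linear])
    then have "(u has_vector_derivative (transpose P *v (- (H *v v s))) $ i) (at s within {0..})"
      unfolding u_def by (intro bounded_linear.has_vector_derivative[OF bounded_linear_vec_nth])
    moreover have "(transpose P *v (- (H *v v s))) $ i = - lam i * u s"
      by (simp add: linear_neg[OF matrix_vector_mul_linear] H_diagonal[OF sp] diag_mat_mult_vec u_def)
    ultimately show ?thesis by simp
  qed
  \<comment> \<open>Integrating factor: multiplied by the inverse decay, the coordinate has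
    derivative 0 and is therefore constant.\<close>
  have "((\<lambda>s. exp (lam i * s) * u s) has_field_derivative 0) (at s within {0..})"
    if "s \<in> {0..}" for s
    using u[of s] that unfolding has_real_derivative_iff_has_vector_derivative [symmetric]
    by (auto intro!: derivative_eq_intros simp: algebra_simps)
  then obtain c where "\<And>s. s \<in> {0..} \<Longrightarrow> exp (lam i * s) * u s = c"
    using has_field_derivative_zero_constant[of "{0::real..}" "\<lambda>s. exp (lam i * s) * u s"] by auto
  from this[of t] this[of 0] t have "exp (lam i * t) * u t = u 0" by simp
  then have "u t = exp (- lam i * t) * u 0"
    by (simp add: exp_minus field_simps)
  then show ?thesis by (simp add: u_def)
qed

lemma spectral_recover:
  assumes "spectral_data"
  shows "x = (\<Sum>i\<in>UNIV. (transpose P *v x) $ i *\<^sub>R column i P)"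
proof -
  have "x = P *v (transpose P *v x)"
    using assms by (simp add: matrix_vector_mul_assoc spectral_data_def orthogonal_matrix_def)
  also have "\<dots> = (\<Sum>i\<in>UNIV. (transpose P *v x) $ i *\<^sub>R column i P)"
    by (simp add: matrix_mult_sum scalar_mult_eq_scaleR)
  finally show ?thesis .
qed

lemma v_spectral:
  assumes "is_gradient_flow" "spectral_data" "t \<ge> 0"
  shows "v t = (\<Sum>i\<in>UNIV. exp (- lam i * t) *\<^sub>R w i)"
  using spectral_recover[OF assms(2), of "v t"]
  by (simp only: w_def spectral_coordinate[OF assms] scaleR_scaleR)

lemma H_w:
  assumes "spectral_data"
  shows "H *v w i = lam i *\<^sub>R w i"
proof -
  have "H *v column i P = (P ** diag_mat lam ** transpose P ** P) *v axis i 1"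
    using assms by (simp add: spectral_data_def matrix_vector_mul_assoc [symmetric] flip: matrix_vector_mult_basis)
  also have "\<dots> = P *v (diag_mat lam *v axis i 1)"
    using assms by (metis matrix_mul_assoc matrix_mul_rid matrix_vector_mul_assoc orthogonal_matrix_def spectral_data_def)
  also have "diag_mat lam *v axis i 1 = lam i *\<^sub>R axis i 1"
    by (simp add: vec_eq_iff diag_mat_mult_vec axis_def)
  also have "P *v \<dots> = lam i *\<^sub>R column i P"
    by (simp add: matrix_vector_mult_scaleR matrix_vector_mult_basis)
  finally show ?thesis
    by (simp add: w_def matrix_vector_mult_scaleR)
qed

section \<open>The derivative of the loss\<close>

text \<open>The cut at \<alpha> disappears: \<open>Delta\<close> collects the modes beyond \<alpha>
  and enters \<open>Phi\<close> through \<open>- Omega\<close> with a plus sign, so the leading sum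
  is completed to all modes of \<open>v t\<close>.\<close>

lemma Phi_eq:
  assumes "is_gradient_flow" "spectral_data" "t \<ge> 0"
  shows "Phi t = sgn_vec (v t) \<bullet> (H *v v t) - real CARD('n) * Psi t"
proof -
  have un: "UNIV = {..\<alpha>} \<union> {\<alpha><..}" by auto
  have "v t = (\<Sum>i\<in>{..\<alpha>}. exp (- lam i * t) *\<^sub>R w i) + (\<Sum>j\<in>{\<alpha><..}. exp (- lam j * t) *\<^sub>R w j)"
    unfolding v_spectral[OF assms] un by (rule sum.union_disjoint) auto
  then have Hv: "H *v v t = H *v (\<Sum>i\<in>{..\<alpha>}. exp (- lam i * t) *\<^sub>R w i) +
      H *v (\<Sum>j\<in>{\<alpha><..}. exp (- lam j * t) *\<^sub>R w j)"
    by (simp only: matrix_vector_right_distrib)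
  have "sgn_vec (v t) \<bullet> (H *v v t) =
      sgn_vec (v t) \<bullet> (H *v (\<Sum>i\<in>{..\<alpha>}. exp (- lam i * t) *\<^sub>R w i)) + Delta t"
    by (simp only: Hv Delta_def inner_add_right)
  also have "H *v (\<Sum>i\<in>{..\<alpha>}. exp (- lam i * t) *\<^sub>R w i) = (\<Sum>i\<in>{..\<alpha>}. exp (- lam i * t) *\<^sub>R (H *v w i))"
    by (simp add: linear_sum[OF matrix_vector_mul_linear] matrix_vector_mult_scaleR)
  also have "sgn_vec (v t) \<bullet> \<dots> = (\<Sum>i\<in>{..\<alpha>}. Gamma_i i t * exp (- lam i * t))"
    by (simp add: inner_sum_right Gamma_i_def mult.commute)
  finally show ?thesis
    by (simp add: Phi_def Omega_def)
qed

text \<open>Identifies the vector normalised in \<open>Psi_formula\<close> with \<open>a t\<close>,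
  so that the formula can be read as a derivative of the norm along the flow.\<close>

lemma pseudoinverse_residual:
  assumes flow: "is_gradient_flow" and sp: "spectral_data" and t: "t \<ge> 0"
  shows "pseudoinverse K *v (v t + y) = a t"
proof -
  let ?X = "pseudoinverse K"
  \<comment> \<open>The derivative of \<open>a\<close> lies in the range of \<open>transpose K\<close>, on which \<open>?X ** K\<close> is the identity.\<close>
  define g where "g s = (?X ** K) *v a s - a s" for s
  have "(g has_vector_derivative 0) (at s within {0..})" if "s \<in> {0..}" for s
  proof -
    have a: "(a has_vector_derivative - (transpose K *v v s)) (at s within {0..})"
      using flow that by (auto simp: is_gradient_flow_def)
    have "(g has_vector_derivative
        (?X ** K) *v (- (transpose K *v v s)) - (- (transpose K *v v s))) (at s within {0..})"
      unfolding g_def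
      by (intro has_vector_derivative_diff a
          bounded_linear.has_vector_derivative[OF matrix_vector_mul_bounded_linear])
    moreover have "(?X ** K) *v (- (transpose K *v v s)) = - (transpose K *v v s)"
      by (simp only: linear_neg[OF matrix_vector_mul_linear] matrix_vector_mul_assoc
          pseudoinverse_mult_transpose[OF is_pseudoinverse_K[OF sp]])
    ultimately show ?thesis by simp
  qed
  then obtain c where "\<And>s. s \<in> {0..} \<Longrightarrow> g s = c"
    using has_vector_derivative_zero_constant[of "{0::real..}" g] by auto
  from this[of t] this[of 0] t have "g t = g 0" by simp
  moreover have "g 0 = 0"
    using flow by (simp add: g_def is_gradient_flow_def)
  ultimately show ?thesis
    by (simp add: g_def v_def matrix_vector_mul_assoc)
qed

lemma norm_a_has_derivative:
  assumes flow: "is_gradient_flow" and sp: "spectral_data" and t: "t > 0"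
  shows "((\<lambda>s. 2 * C * norm (a s) / sqrt (real CARD('n))) has_real_derivative Psi t) (at t)"
proof (cases "transpose K *v y = 0")
  case True
  have v0: "v 0 = - y"
    using flow by (simp add: v_def is_gradient_flow_def)
  have "H *v v 0 = 0"
    using True by (simp add: v0 H_def linear_neg[OF matrix_vector_mul_linear] matrix_vector_mul_assoc [symmetric])
  then have "lam i * (transpose P *v v 0) $ i = 0" for i
    by (metis H_diagonal[OF sp] diag_mat_mult_vec matrix_vector_mult_0_right zero_index)
  then have u: "lam i = 0 \<or> (transpose P *v v 0) $ i = 0" for i
    by simp
  have v: "v s = - y" if "s \<ge> 0" for s
  proof -
    \<comment> \<open>No mode moves: either its rate or its amplitude is 0.\<close>
    have "exp (- lam i * s) *\<^sub>R w i = exp (- lam i * 0) *\<^sub>R w i" for i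
      using u[of i] by (auto simp: w_def)
    then have "v s = v 0"
      using v_spectral[OF flow sp that] v_spectral[OF flow sp order_refl] by presburger
    then show ?thesis by (simp add: v0)
  qed
  have "a s = 0" if "s \<ge> 0" for s
    using pseudoinverse_residual[OF flow sp that] v[OF that] by simp
  \<comment> \<open>Vanishing is known only at nonnegative times; for positive \<open>t\<close>
    these include a neighbourhood of \<open>t\<close>.\<close>
  then have "\<forall>\<^sub>F s in nhds t. 2 * C * norm (a s) / sqrt (real CARD('n)) = 0"
    using t by (intro eventually_mono[OF eventually_nhds_in_open[of "{0<..}"]]) auto
  from DERIV_cong_ev[OF refl this refl] show ?thesis
    using True by (simp add: Psi_def)
next
  case False
  have at: "at t within {0..} = at t"
    using t by (intro at_within_interior) simp
  \<comment> \<open>If \<open>a\<close> returned to 0, \<open>v\<close> would return to its initial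
    value. Every mode with a positive rate would then have amplitude 0, so
    \<open>H *v v 0 = 0\<close>, which forces \<open>transpose K *v y = 0\<close>.\<close>
  have "a t \<noteq> 0"
  proof
    assume "a t = 0"
    then have eq: "v t = v 0"
      using flow by (simp add: v_def is_gradient_flow_def)
    have "lam i * (transpose P *v v 0) $ i = 0" for i
    proof -
      have "(transpose P *v v 0) $ i = exp (- lam i * t) * (transpose P *v v 0) $ i"
        using spectral_coordinate[OF flow sp, of t i] t eq by simp
      then show ?thesis using t by auto
    qed
    then have "H *v v 0 = 0"
      by (subst spectral_recover[OF sp, of "H *v v 0"])
        (simp only: H_diagonal[OF sp] diag_mat_mult_vec scaleR_zero_left sum.neutral_const)
    then have "transpose K *v v 0 = 0"
      using gram_inner[of "v 0"] by simp
    moreover have "v 0 = - y"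
      using flow by (simp add: v_def is_gradient_flow_def)
    ultimately show False
      using False by (simp add: linear_neg[OF matrix_vector_mul_linear])
  qed
  have "(a has_vector_derivative - (transpose K *v v t)) (at t)"
    using flow t at by (auto simp: is_gradient_flow_def dest!: spec[of _ t])
  then have "((\<lambda>s. norm (a s)) has_real_derivative - (transpose K *v v t) \<bullet> sgn (a t)) (at t)"
    unfolding has_vector_derivative_def has_field_derivative_def
    using has_derivative_compose[where f = a and g = norm, OF _ has_derivative_norm[OF \<open>a t \<noteq> 0\<close>]]
    by (fastforce elim: has_derivative_eq_rhs)
  from DERIV_cmult[OF this, of "2 * C / sqrt (real CARD('n))"]
  have "((\<lambda>s. 2 * C * norm (a s) / sqrt (real CARD('n))) has_real_derivative
      2 * C / sqrt (real CARD('n)) * (- (transpose K *v v t) \<bullet> sgn (a t))) (at t)"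
    by (simp add: mult_ac)
  moreover have "Psi t = 2 * C / sqrt (real CARD('n)) * (- (transpose K *v v t) \<bullet> sgn (a t))"
    using False t pseudoinverse_residual[OF flow sp, of t]
    by (simp add: Psi_def Psi_formula_def Let_def sgn_div_norm inner_commute divide_inverse)
  ultimately show ?thesis by simp
qed

lemma dloss_eq:
  assumes flow: "is_gradient_flow" and sp: "spectral_data" and t: "t \<ge> 0"
  shows "dloss t = - Phi t / real CARD('n)"
proof -
  have conv: "dloss t = - (1 / real CARD('n)) * (sgn_vec (v t) \<bullet> (H *v v t)) + Psi t"
  proof (cases "t > 0 \<and> loss differentiable (at t)")
    case False
    \<comment> \<open>This branch contains time 0, where the limit \<open>Psi 0\<close> is carried
      along as a symbol.\<close>
    then show ?thesis by (simp only: dloss_def if_False)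
  next
    case True
    then have t: "t > 0" by simp
    define N where "N s = 2 * C * norm (a s) / sqrt (real CARD('n))" for s
    have N: "(N has_real_derivative Psi t) (at t)"
      unfolding N_def by (rule norm_a_has_derivative[OF flow sp t])
    have at: "at t within {0..} = at t"
      using t by (intro at_within_interior) simp
    have vi: "((\<lambda>s. v s $ i) has_real_derivative - (H *v v t) $ i) (at t)" for i
      using bounded_linear.has_vector_derivative[OF bounded_linear_vec_nth v_has_derivative[OF flow], of t i] t at
      by (simp add: has_real_derivative_iff_has_vector_derivative)
    \<comment> \<open>Solving for the sum of absolute values shows that it inherits
      differentiability from \<open>loss\<close> and \<open>N\<close>, as
      \<open>sum_abs_has_derivative\<close> demands.\<close>
    have eq: "(\<Sum>i\<in>UNIV. \<bar>v s $ i\<bar>) = real CARD('n) * (loss s - N s)" for s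
      by (simp add: loss_def N_def)
    have "(\<lambda>s. real CARD('n) * (loss s - N s)) differentiable (at t)"
      using True N real_differentiable_def by (intro differentiable_mult differentiable_diff) auto
    then have "((\<lambda>s. \<Sum>i\<in>UNIV. \<bar>v s $ i\<bar>) has_real_derivative
        (\<Sum>i\<in>UNIV. sgn1 (v t $ i) * - (H *v v t) $ i)) (at t)"
      using vi by (intro sum_abs_has_derivative) (auto simp: eq)
    from DERIV_add[OF DERIV_cmult[OF this, of "1 / real CARD('n)"] N]
    have "deriv loss t = (1 / real CARD('n)) * (\<Sum>i\<in>UNIV. sgn1 (v t $ i) * - (H *v v t) $ i) + Psi t"
      by (intro DERIV_imp_deriv) (simp add: loss_def[abs_def] N_def)
    also have "(\<Sum>i\<in>UNIV. sgn1 (v t $ i) * - (H *v v t) $ i) = - (sgn_vec (v t) \<bullet> (H *v v t))"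
      by (simp add: inner_vec_def sgn_vec_def sum_negf)
    finally show ?thesis
      using True by (simp add: dloss_def)
  qed
  show ?thesis
    unfolding conv Phi_eq[OF assms] by (simp add: field_simps)
qed

lemma dloss_neg_iff:
  assumes "is_gradient_flow" "spectral_data" "t \<ge> 0"
  shows "dloss t < 0 \<longleftrightarrow> Phi t > 0"
  unfolding dloss_eq[OF assms] by (simp add: field_simps)

section \<open>Suprema of good times and infima of failure times\<close>

text \<open>\<open>T1\<close> is closed downwards within the nonnegative reals, so every time tested
  before some \<open>s\<close> in \<open>T1\<close> lies in \<open>T1\<close> itself.\<close>

lemma sup_time_mono:
  assumes "\<And>t. t \<in> T1 \<Longrightarrow> Q t \<Longrightarrow> R t"
  shows "sup_time Q \<le> sup_time R"
proof -
  have "t \<in> T1" if "s \<in> T1" "0 \<le> t" "t < s" for s t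
    using that less_trans[of "ereal t" "ereal s" \<tau>] by (simp add: T1_def)
  then show ?thesis
    unfolding sup_time_def using assms by (intro Sup_subset_mono image_mono) auto
qed

text \<open>An admissible \<open>s\<close> cannot exceed a failure time \<open>t\<close>, since
  \<open>t\<close> would lie in \<open>{0..<s}\<close>.\<close>

lemma sup_time_le_Inf:
  "sup_time Q \<le> Inf (ereal ` {t. 0 \<le> t \<and> \<not> Q t})"
  unfolding sup_time_def by (force intro!: Sup_least Inf_greatest simp: not_le[symmetric])

text \<open>\<open>Q\<close> holds strictly before its first failure, so the infimum, being in
  \<open>T1\<close>, is itself an admissible \<open>s\<close>.\<close>

lemma sup_time_eq_Inf:
  assumes "Inf (ereal ` {t. 0 \<le> t \<and> \<not> Q t}) \<in> ereal ` T1" (is "?i \<in> _")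
  shows "sup_time Q = ?i"
proof (rule antisym[OF sup_time_le_Inf])
  obtain s where s: "?i = ereal s" "s \<in> T1" using assms by auto
  have "Q t" if "0 \<le> t" "t < s" for t
  proof (rule ccontr)
    assume "\<not> Q t"
    then have "?i \<le> ereal t" using that by (intro Inf_lower) auto
    then show False using s that by simp
  qed
  then show "?i \<le> sup_time Q"
    unfolding sup_time_def s(1) using s(2) by (intro Sup_upper imageI) auto
qed

text \<open>The infimum is nonnegative, so a value below \<tau> would be finite and belong to
  \<open>T1\<close>. Without failures it is infinite.\<close>

lemma Inf_ge_tau:
  assumes "Inf (ereal ` {t. 0 \<le> t \<and> \<not> Q t}) \<notin> ereal ` T1" (is "?i \<notin> _")
  shows "\<tau> \<le> ?i"
proof (rule ccontr)
  assume "\<not> \<tau> \<le> ?i"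
  moreover have "0 \<le> ?i" by (auto intro!: Inf_greatest)
  ultimately have "?i \<in> ereal ` T1"
    by (cases ?i) (auto simp: T1_def)
  with assms show False ..
qed

lemma sup_time_eq_tau:
  assumes "\<tau> > 0" and "Inf (ereal ` {t. 0 \<le> t \<and> \<not> Q t}) \<notin> ereal ` T1"
  shows "sup_time Q = \<tau>"
proof (rule antisym)
  show "sup_time Q \<le> \<tau>"
    unfolding sup_time_def by (auto intro!: Sup_least simp: T1_def)
  have Q: "Q t" if "0 \<le> t" "ereal t < \<tau>" for t
  proof (rule ccontr)
    assume "\<not> Q t"
    then have "Inf (ereal ` {t. 0 \<le> t \<and> \<not> Q t}) \<le> ereal t"
      using that by (intro Inf_lower) auto
    with Inf_ge_tau[OF assms(2)] that show False by simp
  qed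
  show "\<tau> \<le> sup_time Q"
  \<comment> \<open>\<tau> is outside \<open>T1\<close> and may be infinite, so it is approached
    from below by real times, all of them admissible.\<close>
  proof (rule dense_le_bounded[OF assms(1)])
    fix z assume z: "0 < z" "z < \<tau>"
    then obtain s where s: "z = ereal s" by (cases z) auto
    have "Q t" if "0 \<le> t" "t < s" for t
      using Q that z s less_trans[of "ereal t" "ereal s" \<tau>] by simp
    then show "z \<le> sup_time Q"
      unfolding sup_time_def s using z s by (intro Sup_upper imageI) (auto simp: T1_def)
  qed
qed

section \<open>Logarithmic bounds from the extreme leading eigenvalues\<close>

text \<open>Sign invariance makes every \<open>Gamma_i\<close> with index up to \<alpha> and
  \<open>Omega\<close> positive on all of \<open>T1\<close>. Hence \<open>Phi\<close> lies between
  two single-exponential expressions whose positivity is exactly the logarithmic inequality.\<close>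

lemma t_plus_bounds:
  assumes sp: "spectral_data" and tau: "\<tau> > 0" and inv: "T1_sign_invariant"
    and I: "I_minus = {}" and Om0: "Omega 0 > 0"
  shows "t_plus_i (Min UNIV) \<le> t_plus" "t_plus \<le> t_plus_i \<alpha>"
proof -
  have zero: "0 \<in> T1" using tau by (simp add: T1_def zero_ereal_def)
  have G: "Gamma_i i t > 0" if "i \<le> \<alpha>" "t \<in> T1" for i t
    using inv I that unfolding T1_sign_invariant_def sign_invariant_on_def I_minus_def by auto
  have Om: "Omega t > 0" if "t \<in> T1" for t
    using inv Om0 zero that unfolding T1_sign_invariant_def sign_invariant_on_def by force
  have lam_pos: "lam i > 0" if "i \<le> \<alpha>" for i
  proof -
    \<comment> \<open>\<open>w i\<close> is an eigenvector or 0, so \<open>Gamma_i\<close> carries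
      the factor \<open>lam i\<close> and would vanish with it.\<close>
    have "lam i \<noteq> 0"
      using G[OF that zero] by (auto simp: Gamma_i_def H_w[OF sp])
    then show ?thesis
      using sp by (metis spectral_data_def less_eq_real_def)
  qed
  have anti: "lam j \<le> lam i" if "i \<le> j" for i j
    using sp that by (simp add: spectral_data_def)
  have Gpos: "Gamma t > 0" if "t \<in> T1" for t
    unfolding Gamma_def using G that by (intro sum_pos) auto
  have iff: "t < 1 / lam i * ln (Gamma t / Omega t) \<longleftrightarrow> Omega t < Gamma t * exp (- lam i * t)"
    if "i \<le> \<alpha>" "t \<in> T1" for i t
  proof -
    have "t < 1 / lam i * ln (Gamma t / Omega t) \<longleftrightarrow> lam i * t < ln (Gamma t / Omega t)"
      using lam_pos[OF that(1)] by (simp add: field_simps)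
    also have "\<dots> \<longleftrightarrow> exp (lam i * t) < Gamma t / Omega t"
      using Om[OF that(2)] Gpos[OF that(2)] by (metis divide_pos_pos exp_less_cancel_iff exp_ln)
    also have "\<dots> \<longleftrightarrow> Omega t < Gamma t * exp (- lam i * t)"
      using Om[OF that(2)] by (simp add: exp_minus field_simps)
    finally show ?thesis .
  qed
  have min: "Min UNIV \<le> i" for i :: 'n by simp
  \<comment> \<open>At nonnegative times the exponential decreases in the rate, the weights are
    positive, and the rates up to \<alpha> lie between \<open>lam \<alpha>\<close> and
    \<open>lam (Min UNIV)\<close>.\<close>
  have lower: "Gamma t * exp (- lam (Min UNIV) * t) \<le> (\<Sum>i\<in>{..\<alpha>}. Gamma_i i t * exp (- lam i * t))"
    and upper: "(\<Sum>i\<in>{..\<alpha>}. Gamma_i i t * exp (- lam i * t)) \<le> Gamma t * exp (- lam \<alpha> * t)"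
    if "t \<in> T1" for t
    unfolding Gamma_def sum_distrib_right using G that anti min
    by (auto intro!: sum_mono mult_left_mono mult_right_mono simp: less_imp_le T1_def)
  show "t_plus_i (Min UNIV) \<le> t_plus"
    unfolding t_plus_i_def t_plus_def
  proof (rule sup_time_mono)
    fix t assume "t \<in> T1" "t < 1 / lam (Min UNIV) * ln (Gamma t / Omega t)"
    then show "Phi t > 0"
      using iff[OF min] lower unfolding Phi_def by fastforce
  qed
  show "t_plus \<le> t_plus_i \<alpha>"
    unfolding t_plus_i_def t_plus_def
  proof (rule sup_time_mono)
    fix t assume "t \<in> T1" "Phi t > 0"
    then show "t < 1 / lam \<alpha> * ln (Gamma t / Omega t)"
      using iff[OF order_refl] upper unfolding Phi_def by fastforce
  qed
qed

end

theorem proposition7: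
  fixes h :: "'n::{finite,linorder} \<Rightarrow> real^'m"
    and y :: "real^'n::_"
    and C :: real
    and a :: "real \<Rightarrow> real^'m"
    and lam :: "'n \<Rightarrow> real"
    and P :: "real^'n::_^'n::_"
    and \<alpha> :: 'n
    and \<tau> :: ereal
  defines "dL \<equiv> flow.dloss h y C a"
    and "\<Gamma> \<equiv> flow.Gamma h y a P \<alpha>"
    and "\<Omega> \<equiv> flow.Omega h y C a lam P \<alpha>"
    and "\<Phi> \<equiv> flow.Phi h y C a lam P \<alpha>"
    and "ts \<equiv> flow.t_star h y C a"
    and "tp \<equiv> flow.t_plus h y C a lam P \<alpha> \<tau>"
    and "tpi \<equiv> flow.t_plus_i h y C a lam P \<alpha> \<tau>"
  assumes "C > 0"
    and "flow.is_gradient_flow h y a"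
    and "flow.spectral_data h lam P"
    and "\<tau> > 0"
    and "flow.T1_sign_invariant h y C a lam P \<alpha> \<tau>"
    and "\<Phi> 0 > 0"
  shows "(\<forall>t\<ge>0. dL t < 0 \<longleftrightarrow> \<Phi> t > 0)
    \<and> tp = flow.sup_time \<tau> (\<lambda>t. dL t < 0)
    \<and> tp \<le> ts
    \<and> (ts \<in> ereal ` flow.T1 \<tau> \<longrightarrow> tp = ts \<and> ts < \<tau>)
    \<and> (ts \<notin> ereal ` flow.T1 \<tau> \<longrightarrow> tp = \<tau> \<and> \<tau> \<le> ts)
    \<and> (flow.I_minus h y a P \<alpha> \<tau> = {} \<and> \<Gamma> 0 > \<Omega> 0 \<and> \<Omega> 0 > 0
        \<longrightarrow> tpi (Min UNIV) \<le> tp \<and> tp \<le> tpi \<alpha>)"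
proof -
  interpret flow h y C a lam P \<alpha> \<tau> .
  note flow = \<open>is_gradient_flow\<close> and sp = \<open>spectral_data\<close>
  have iff: "dloss t < 0 \<longleftrightarrow> Phi t > 0" if "t \<ge> 0" for t
    using dloss_neg_iff[OF flow sp that] .
  have sup: "t_plus = sup_time (\<lambda>t. dloss t < 0)"
    unfolding t_plus_def by (intro antisym sup_time_mono) (auto simp: iff T1_def)
  \<comment> \<open>Written as an infimum of failure times, \<open>t_star\<close> fits the lemmas on
    \<open>sup_time\<close>.\<close>
  have star: "t_star = Inf (ereal ` {t. 0 \<le> t \<and> \<not> dloss t < 0})"
    by (simp add: t_star_def not_less)
  have "t_plus \<le> t_star"
    unfolding sup star by (rule sup_time_le_Inf)
  moreover have "t_plus = t_star \<and> t_star < \<tau>" if "t_star \<in> ereal ` T1"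
    using that sup_time_eq_Inf[of "\<lambda>t. dloss t < 0"] by (auto simp: sup star T1_def)
  moreover have "t_plus = \<tau> \<and> \<tau> \<le> t_star" if "t_star \<notin> ereal ` T1"
    using that sup_time_eq_tau[OF \<open>\<tau> > 0\<close>, of "\<lambda>t. dloss t < 0"] Inf_ge_tau[of "\<lambda>t. dloss t < 0"]
    by (simp add: sup star)
  moreover have "t_plus_i (Min UNIV) \<le> t_plus \<and> t_plus \<le> t_plus_i \<alpha>"
    if "I_minus = {}" "Omega 0 > 0"
    using t_plus_bounds[OF sp \<open>\<tau> > 0\<close> \<open>T1_sign_invariant\<close> that] by simp
  ultimately show ?thesis
    unfolding assms(1-7) using iff sup by blast
qed

end
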